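(* Let $p\ge1$ and let $\mathfrak g$ be the simple Lie algebra of type $\mathbf A_p$. Then for every $i=0,1,\dots,p$, $$\#\mathfrak{Ad}(\mathbf A_p)_i=\frac{i+1}{p+1}\binom{2p-i}{p}.$$
   Context: Let $\Delta$ be the root system of type $\mathbf A_p$, with positive roots $\Delta^+$ and simple roots $\Pi$. An $\mathsf{ad}$-nilpotent ideal is a subset $I\subset\Delta^+$ such that $\gamma\in I$, $\nu\in\Delta^+$, $\gamma+\nu\in\Delta$ imply $\gamma+\nu\in I$ (these are the sets of roots of the ideals of the Borel subalgebra $\mathfrak b$ contained in $[\mathfrak b,\mathfrak b]$). $\mathfrak{Ad}(\mathbf A_p)_i$ is the set of those $\mathsf{ad}$-nilpotent ideals $I$ with $\#(I\cap\Pi)=i$. *)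

theory Defs
  imports Complex_Main "HOL-Library.Function_Algebras"
begin

text \<open>
  The root system of type \<open>A\<^sub>p\<close> in its standard realisation: the ambient space is
  \<open>\<real>\<^sup>p\<^sup>+\<^sup>1\<close>, whose vectors are represented as functions \<open>nat \<Rightarrow> real\<close> supported on
  \<open>{1..p+1}\<close>, with pointwise addition.
\<close>

definition basis_vec :: "nat \<Rightarrow> nat \<Rightarrow> real" where
  "basis_vec i = (\<lambda>k. if k = i then 1 else 0)"

definition roots_A :: "nat \<Rightarrow> (nat \<Rightarrow> real) set" where
  "roots_A p = {basis_vec i - basis_vec j | i j. i \<in> {1..p+1} \<and> j \<in> {1..p+1} \<and> i \<noteq> j}"

definition pos_roots_A :: "nat \<Rightarrow> (nat \<Rightarrow> real) set" where
  "pos_roots_A p = {basis_vec i - basis_vec j | i j. i \<in> {1..p+1} \<and> j \<in> {1..p+1} \<and> i < j}"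

definition simple_roots_A :: "nat \<Rightarrow> (nat \<Rightarrow> real) set" where
  "simple_roots_A p = {basis_vec i - basis_vec (i + 1) | i. i \<in> {1..p}}"

definition ad_nilpotent_ideal :: "'v::plus set \<Rightarrow> 'v set \<Rightarrow> 'v set \<Rightarrow> bool" where
  "ad_nilpotent_ideal \<Delta> \<Delta>pos I \<longleftrightarrow>
     I \<subseteq> \<Delta>pos \<and> (\<forall>\<gamma>\<in>I. \<forall>\<nu>\<in>\<Delta>pos. \<gamma> + \<nu> \<in> \<Delta> \<longrightarrow> \<gamma> + \<nu> \<in> I)"

definition Ad_A :: "nat \<Rightarrow> nat \<Rightarrow> (nat \<Rightarrow> real) set set" where
  "Ad_A p i = {I. ad_nilpotent_ideal (roots_A p) (pos_roots_A p) I
                  \<and> card (I \<inter> simple_roots_A p) = i}"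

end

theory Submission
  imports Defs
begin

text \<open>
  Write a positive root as \<open>e\<^sub>i - e\<^sub>j\<close> with \<open>i < j\<close>. An ad-nilpotent ideal is closed under
  decreasing \<open>i\<close> and increasing \<open>j\<close>, so it is determined by the numbers \<open>x\<^sub>i\<close> of positive roots
  \<open>e\<^sub>i - e\<^sub>j\<close> outside the ideal, for \<open>i = p, \<dots>, 1\<close>. These form an arbitrary sequence of naturals
  with \<open>x\<^sub>p \<le> 1\<close> and \<open>x\<^sub>i \<le> x\<^sub>i\<^sub>+\<^sub>1 + 1\<close>, and the \<open>i\<close>-th simple root lies in the ideal iff
  \<open>x\<^sub>i = 0\<close>. Sequences of this kind with a general starting bound and a prescribed
  number of zeros satisfy the recursion of the ballot numbers.
\<close>

section \<open>Ballot numbers\<close>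

text \<open>\<open>ballot q s\<close> is the coefficient of \<open>x ^ q\<close> in the power \<open>s + 1\<close> of the Catalan series.\<close>

fun ballot :: "nat \<Rightarrow> nat \<Rightarrow> nat" where
  "ballot 0 s = 1"
| "ballot (Suc q) 0 = ballot q 1"
| "ballot (Suc q) (Suc s) = ballot (Suc q) s + ballot q (s + 2)"

text \<open>By Pascal's rule the reflection-principle difference of neighbouring binomials obeys the
  recursion of \<open>ballot\<close>. The additive form avoids truncated subtraction.\<close>

lemma ballot_binomial_diff:
  "ballot q s + (if q = 0 then 0 else (2 * q + s) choose (q - 1)) = (2 * q + s) choose q"
proof (induction q s rule: ballot.induct)
  case (2 q)
  have "Suc (2 * q) choose Suc q = Suc (2 * q) choose q"
    using binomial_symmetric[of "Suc q" "Suc (2 * q)"] by simp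
  then show ?case
    using 2 by (cases q) (simp_all add: algebra_simps)
next
  case (3 q s)
  then show ?case
    by (cases q) (simp_all add: algebra_simps)
qed simp

lemma ballot_closed_form:
  "(q + s + 1) * ballot q s = (s + 1) * ((2 * q + s) choose q)"
proof (cases q)
  case (Suc r)
  have diff: "ballot q s + ((2 * q + s) choose (q - 1)) = (2 * q + s) choose q"
    using ballot_binomial_diff[of q s] Suc by (simp only: nat.distinct if_False)
  \<comment> \<open>The two binomials of the difference are in ratio \<open>q + s + 1\<close> to
    \<open>q\<close>, so scaling by \<open>q + s + 1\<close> leaves one binomial with factor
    \<open>s + 1\<close>.\<close>
  have "Suc r * ((2 * q + s) choose Suc r) = (2 * q + s - r) * ((2 * q + s) choose r)"
    by (simp only: binomial_absorb_comp binomial_absorption)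
  moreover have "2 * q + s - r = q + s + 1"
    using Suc by simp
  ultimately have "(q + s + 1) * ((2 * q + s) choose (q - 1)) = q * ((2 * q + s) choose q)"
    using Suc by (simp del: binomial_Suc_Suc)
  moreover have "(q + s + 1) * ballot q s + (q + s + 1) * ((2 * q + s) choose (q - 1))
      = (q + s + 1) * ((2 * q + s) choose q)"
    by (simp only: diff flip: distrib_left)
  ultimately show ?thesis
    by (simp add: algebra_simps)
qed simp

section \<open>Sequences growing by at most one\<close>

fun slow :: "nat \<Rightarrow> nat list \<Rightarrow> bool" where
  "slow a [] \<longleftrightarrow> True"
| "slow a (x # xs) \<longleftrightarrow> x \<le> a + 1 \<and> slow x xs"

definition slow_lists :: "nat \<Rightarrow> nat \<Rightarrow> nat \<Rightarrow> nat list set" where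
  "slow_lists p a m = {xs. length xs = p \<and> slow a xs \<and> count_list xs 0 = m}"

lemma slow_iff_nth:
  "slow a xs \<longleftrightarrow> (\<forall>k < length xs. xs ! k \<le> (if k = 0 then a else xs ! (k - 1)) + 1)"
proof (induction a xs rule: slow.induct)
  case (2 a x xs)
  show ?case
    unfolding slow.simps 2
    by (auto simp: All_less_Suc2 nth_Cons' split: if_splits)
qed simp

lemma slow_lists_0: "slow_lists 0 a m = (if m = 0 then {[]} else {})"
  by (auto simp: slow_lists_def)

text \<open>Split by the first entry, 0 or 1; a leading 0 uses up one of the \<open>m\<close>
  zeros.\<close>

lemma slow_lists_Suc_0:
  "slow_lists (Suc p) 0 m =
     (if m = 0 then {} else (#) 0 ` slow_lists p 0 (m - 1)) \<union> (#) 1 ` slow_lists p 1 m"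
  by (auto simp: slow_lists_def length_Suc_conv le_Suc_eq image_iff)

lemma slow_lists_Suc_Suc:
  "slow_lists (Suc p) (Suc a) m = slow_lists (Suc p) a m \<union> (#) (a + 2) ` slow_lists p (a + 2) m"
  by (auto simp: slow_lists_def length_Suc_conv le_Suc_eq image_iff)

lemma finite_slow_lists: "finite (slow_lists p a m)"
proof (induction p arbitrary: a m)
  case (Suc p)
  show ?case
    by (induction a) (simp_all add: slow_lists_Suc_0 slow_lists_Suc_Suc Suc)
qed (simp add: slow_lists_0)

text \<open>With \<open>q = p - m\<close> and \<open>s = a + m\<close>, splitting off the first
  entry turns into the equations of \<open>ballot\<close>.\<close>

lemma card_slow_lists:
  "card (slow_lists p a m) = (if m \<le> p then ballot (p - m) (a + m) else 0)"
proof (induction p arbitrary: a m)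
  case Suc': (Suc p)
  show ?case
  proof (induction a)
    case 0
    have card_eq: "card (slow_lists (Suc p) 0 m) =
        (if m = 0 then 0 else card (slow_lists p 0 (m - 1))) + card (slow_lists p 1 m)"
      unfolding slow_lists_Suc_0
      by (subst card_Un_disjoint) (auto simp: finite_slow_lists card_image)
    \<comment> \<open>These cases match the second equation of \<open>ballot\<close>, its third
      equation, the single all-zero list, and the absence of lists.\<close>
    consider "m = 0" | m' d where "m = Suc m'" "p = m' + Suc d" | "m = Suc p" | "m > Suc p"
      by (metis less_imp_Suc_add linorder_neqE_nat not0_implies_Suc not_less_eq add_Suc_right)
    then show ?case
      unfolding card_eq Suc' by cases auto
  next
    case (Suc a)
    have "slow_lists (Suc p) a m \<inter> (#) (a + 2) ` slow_lists p (a + 2) m = {}"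
    proof -
      have "(a + 2) # ys \<notin> slow_lists (Suc p) a m" for ys
        by (simp add: slow_lists_def)
      then show ?thesis by blast
    qed
    then have "card (slow_lists (Suc p) (Suc a) m) =
        card (slow_lists (Suc p) a m) + card ((#) (a + 2) ` slow_lists p (a + 2) m)"
      unfolding slow_lists_Suc_Suc by (intro card_Un_disjoint finite_imageI finite_slow_lists)
    also have "card ((#) (a + 2) ` slow_lists p (a + 2) m) = card (slow_lists p (a + 2) m)"
      by (rule card_image) simp
    finally have card_eq: "card (slow_lists (Suc p) (Suc a) m) =
        card (slow_lists (Suc p) a m) + card (slow_lists p (a + 2) m)" .
    show ?case
      unfolding card_eq Suc.IH Suc' by (auto simp: Suc_diff_le le_Suc_eq)
  qed
qed (simp add: slow_lists_0)

section \<open>Roots of type A\<close>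

definition root_A :: "nat \<Rightarrow> nat \<Rightarrow> nat \<Rightarrow> real" where
  "root_A i j = basis_vec i - basis_vec j"

lemma root_A_apply: "root_A i j k = (if k = i then 1 else 0) - (if k = j then 1 else 0)"
  by (simp add: root_A_def basis_vec_def)

text \<open>The coordinates 1 and -1 locate the two indices; distinctness excludes the zero
  vector.\<close>

lemma root_A_inject:
  assumes "i \<noteq> j" "k \<noteq> l"
  shows "root_A i j = root_A k l \<longleftrightarrow> i = k \<and> j = l"
proof
  assume eq: "root_A i j = root_A k l"
  show "i = k \<and> j = l"
    using fun_cong[OF eq, of i] fun_cong[OF eq, of j] assms
    by (auto simp: root_A_apply split: if_splits)
qed simp

lemma root_A_add: "root_A i j + root_A j k = root_A i k"
  by (simp add: root_A_def)

lemma roots_A_eq: "roots_A p = {root_A i j | i j. i \<in> {1..p+1} \<and> j \<in> {1..p+1} \<and> i \<noteq> j}"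
  by (simp add: roots_A_def root_A_def)

lemma pos_roots_A_eq: "pos_roots_A p = {root_A i j | i j. 1 \<le> i \<and> i < j \<and> j \<le> p + 1}"
  unfolding pos_roots_A_def root_A_def by fastforce

lemma root_A_in_roots_A:
  "\<lbrakk>1 \<le> i; i \<le> p + 1; 1 \<le> j; j \<le> p + 1; i \<noteq> j\<rbrakk> \<Longrightarrow> root_A i j \<in> roots_A p"
  unfolding roots_A_eq by auto

lemma root_A_in_pos_roots_A:
  "\<lbrakk>1 \<le> i; i < j; j \<le> p + 1\<rbrakk> \<Longrightarrow> root_A i j \<in> pos_roots_A p"
  unfolding pos_roots_A_eq by blast

lemma simple_roots_A_eq: "simple_roots_A p = (\<lambda>i. root_A i (i + 1)) ` {1..p}"
  unfolding simple_roots_A_def root_A_def by auto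

lemma root_A_add_in_roots_D:
  assumes "root_A i j + root_A k l \<in> roots_A p" and "i < j" "k < l"
  shows "j = k \<or> l = i"
proof (rule ccontr)
  assume neg: "\<not> (j = k \<or> l = i)"
  obtain x y where "x \<noteq> y" and eq: "root_A i j + root_A k l = root_A x y"
    using assms(1) by (auto simp: roots_A_eq)
  have "root_A i j z + root_A k l z = root_A x y z" for z
    using fun_cong[OF eq, of z] by simp
  \<comment> \<open>Without cancellation the sum is 1 at both \<open>i\<close> and \<open>k\<close>,
    or 2 there if \<open>i = k\<close>; a root has a single coordinate 1 and none equal to
    2.\<close>
  from this[of i] this[of k] show False
    using neg assms(2,3) \<open>x \<noteq> y\<close> by (auto simp: root_A_apply split: if_splits)
qed

text \<open>Adding a positive root to another gives a root only when an index cancels, and then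
  moves one of the two indices outwards. Moving both takes two additions.\<close>

lemma ad_nilpotent_ideal_A_iff:
  "ad_nilpotent_ideal (roots_A p) (pos_roots_A p) I \<longleftrightarrow>
     I \<subseteq> pos_roots_A p \<and>
     (\<forall>i j i' j'. i < j \<longrightarrow> root_A i j \<in> I \<longrightarrow> 1 \<le> i' \<longrightarrow> i' \<le> i \<longrightarrow> j \<le> j' \<longrightarrow> j' \<le> p + 1
        \<longrightarrow> root_A i' j' \<in> I)"
  (is "?L \<longleftrightarrow> ?R")
proof
  assume L: ?L
  have sub: "I \<subseteq> pos_roots_A p"
    using L by (simp add: ad_nilpotent_ideal_def)
  have add: "\<gamma> + \<nu> \<in> I" if "\<gamma> \<in> I" "\<nu> \<in> pos_roots_A p" "\<gamma> + \<nu> \<in> roots_A p" for \<gamma> \<nu>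
    using L that by (simp add: ad_nilpotent_ideal_def)
  have "root_A i' j' \<in> I"
    if "i < j" "root_A i j \<in> I" "1 \<le> i'" "i' \<le> i" "j \<le> j'" "j' \<le> p + 1" for i j i' j'
  proof -
    have right: "root_A i j' \<in> I"
    proof (cases "j = j'")
      case False
      have "root_A i j + root_A j j' \<in> I"
        by (rule add)
          (use that False in \<open>auto simp: root_A_add intro: root_A_in_roots_A root_A_in_pos_roots_A\<close>)
      then show ?thesis by (simp add: root_A_add)
    qed (use that in simp)
    show ?thesis
    proof (cases "i = i'")
      case False
      have "root_A i j' + root_A i' i = root_A i' j'"
        by (simp add: root_A_def)
      moreover have "root_A i' i \<in> pos_roots_A p" "root_A i' j' \<in> roots_A p"
        using that False by (auto intro: root_A_in_roots_A root_A_in_pos_roots_A)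
      ultimately show ?thesis
        using add[OF right, of "root_A i' i"] by argo
    qed (use right in simp)
  qed
  with sub show ?R by blast
next
  assume R: ?R
  then have up: "\<And>i j i' j'. \<lbrakk>i < j; root_A i j \<in> I; 1 \<le> i'; i' \<le> i; j \<le> j'; j' \<le> p + 1\<rbrakk>
      \<Longrightarrow> root_A i' j' \<in> I"
    by blast
  show ?L
    unfolding ad_nilpotent_ideal_def
  proof (intro conjI ballI impI)
    fix \<gamma> \<nu> assume \<gamma>: "\<gamma> \<in> I" and \<nu>: "\<nu> \<in> pos_roots_A p" and sum: "\<gamma> + \<nu> \<in> roots_A p"
    obtain i j where ij: "\<gamma> = root_A i j" "1 \<le> i" "i < j" "j \<le> p + 1"
      using R \<gamma> by (auto simp: pos_roots_A_eq)
    obtain k l where kl: "\<nu> = root_A k l" "1 \<le> k" "k < l" "l \<le> p + 1"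
      using \<nu> by (auto simp: pos_roots_A_eq)
    consider "j = k" | "l = i"
      using root_A_add_in_roots_D sum ij kl by blast
    then show "\<gamma> + \<nu> \<in> I"
    proof cases
      case 1
      have "root_A i l \<in> I"
        by (rule up[of i j]) (use \<gamma> ij kl 1 in auto)
      then show ?thesis using 1 ij kl by (simp add: root_A_add)
    next
      case 2
      have "root_A k j \<in> I"
        by (rule up[of i j]) (use \<gamma> ij kl 2 in auto)
      then show ?thesis using 2 ij kl by (simp add: root_A_def)
    qed
  qed (use R in blast)
qed

section \<open>Ideals as sequences\<close>

text \<open>The entry \<open>xs ! (p - i)\<close> is the number of missing positive roots \<open>root_A i j\<close>.\<close>

definition ideal_of :: "nat \<Rightarrow> nat list \<Rightarrow> (nat \<Rightarrow> real) set" where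
  "ideal_of p xs = {root_A i j | i j. 1 \<le> i \<and> i + 1 + xs ! (p - i) \<le> j \<and> j \<le> p + 1}"

lemma root_A_in_ideal_of_iff:
  assumes "i < j"
  shows "root_A i j \<in> ideal_of p xs \<longleftrightarrow> 1 \<le> i \<and> i + 1 + xs ! (p - i) \<le> j \<and> j \<le> p + 1"
proof -
  have "root_A i j = root_A k l \<longleftrightarrow> i = k \<and> j = l" if "k + 1 + c \<le> l" for k l c
    using that assms by (intro root_A_inject) auto
  then show ?thesis
    unfolding ideal_of_def mem_Collect_eq by metis
qed

text \<open>Position \<open>k\<close> belongs to the row \<open>i = p - k\<close>, which has exactly
  \<open>k + 1\<close> positive roots.\<close>

lemma slow_0_nth_le:
  assumes "slow 0 xs" "k < length xs"
  shows "xs ! k \<le> k + 1"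
  using assms(2)
proof (induction k)
  case 0
  then show ?case using assms(1) by (fastforce simp: slow_iff_nth)
next
  case (Suc k)
  have "xs ! Suc k \<le> xs ! k + 1"
    using assms(1) Suc.prems unfolding slow_iff_nth by fastforce
  then show ?case using Suc by simp
qed

text \<open>Up to the shift by 1, the offset is the column where row \<open>i\<close> of the ideal
  starts; its monotonicity in \<open>i\<close> gives closure under decreasing
  \<open>i\<close>.\<close>

lemma slow_0_offset_mono:
  assumes "slow 0 xs" "length xs = p" "1 \<le> i" "i \<le> i'" "i' \<le> p"
  shows "i + xs ! (p - i) \<le> i' + xs ! (p - i')"
  using assms(4,5)
proof (induction i' rule: dec_induct)
  case (step n)
  have "p - n < length xs" "p - n \<noteq> 0" "p - n - 1 = p - Suc n"
    using step assms by auto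
  then have "xs ! (p - n) \<le> xs ! (p - Suc n) + 1"
    using assms(1) unfolding slow_iff_nth by metis
  then show ?case using step by simp
qed simp

lemma ideal_of_is_ideal:
  assumes "slow 0 xs" "length xs = p"
  shows "ad_nilpotent_ideal (roots_A p) (pos_roots_A p) (ideal_of p xs)"
  unfolding ad_nilpotent_ideal_A_iff
proof (intro conjI allI impI)
  show "ideal_of p xs \<subseteq> pos_roots_A p"
    unfolding ideal_of_def pos_roots_A_eq by fastforce
next
  fix i j i' j'
  assume *: "i < j" "root_A i j \<in> ideal_of p xs" "1 \<le> i'" "i' \<le> i" "j \<le> j'" "j' \<le> p + 1"
  then have "i + 1 + xs ! (p - i) \<le> j" "i \<le> p"
    using root_A_in_ideal_of_iff[of i j p xs] by auto
  then show "root_A i' j' \<in> ideal_of p xs"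
    using * slow_0_offset_mono[OF assms, of i' i]
    by (subst root_A_in_ideal_of_iff) auto
qed

lemma ideal_of_inject:
  assumes "slow 0 xs" "length xs = p" "slow 0 ys" "length ys = p"
    and eq: "ideal_of p xs = ideal_of p ys"
  shows "xs = ys"
proof (rule nth_equalityI)
  have le: "us ! k \<le> vs ! k"
    if "slow 0 us" "length us = p" "slow 0 vs" "length vs = p" "ideal_of p us = ideal_of p vs"
      "k < p" for us vs k
  \<comment> \<open>If the row is empty in the ideal of \<open>vs\<close>, the general bound on
    \<open>us ! k\<close> suffices. Otherwise the first root of that row lies in both ideals and
    bounds \<open>us ! k\<close>.\<close>
  proof (cases "vs ! k = k + 1")
    case True
    then show ?thesis using slow_0_nth_le[of us k] that by simp
  next
    case False
    then have "vs ! k \<le> k"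
      using slow_0_nth_le[of vs k] that by simp
    then have "root_A (p - k) (p - k + 1 + vs ! k) \<in> ideal_of p vs"
      using that(6) by (subst root_A_in_ideal_of_iff) auto
    then have "p - k + 1 + us ! (p - (p - k)) \<le> p - k + 1 + vs ! k"
      unfolding that(5)[symmetric] by (subst (asm) root_A_in_ideal_of_iff) auto
    then show ?thesis
      using that(6) by simp
  qed
  fix k assume "k < length xs"
  then show "xs ! k = ys ! k"
    using le[of xs ys k] le[of ys xs k] assms by simp
qed (use assms in simp)

lemma ideal_is_ideal_of:
  assumes "ad_nilpotent_ideal (roots_A p) (pos_roots_A p) I"
  obtains xs where "slow 0 xs" "length xs = p" "ideal_of p xs = I"
proof -
  have sub: "I \<subseteq> pos_roots_A p"
    and up: "\<And>i j i' j'. \<lbrakk>i < j; root_A i j \<in> I; 1 \<le> i'; i' \<le> i; j \<le> j'; j' \<le> p + 1\<rbrakk>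
      \<Longrightarrow> root_A i' j' \<in> I"
    using assms unfolding ad_nilpotent_ideal_A_iff by blast+
  \<comment> \<open>The first disjunct makes the least \<open>x\<close> exist even if the ideal has no root \<open>root_A i j\<close>.\<close>
  define Q where "Q i x \<longleftrightarrow> i + x = p + 1 \<or> root_A i (i + 1 + x) \<in> I" for i x
  define d where "d i = (LEAST x. Q i x)" for i
  define xs where "xs = map (\<lambda>k. d (p - k)) [0..<p]"
  have Qd: "Q i (d i)" if "i \<le> p" for i
    unfolding d_def by (rule LeastI[of _ "p + 1 - i"]) (use that in \<open>simp add: Q_def\<close>)
  have d_le: "d i \<le> x" if "Q i x" for i x
    unfolding d_def using that by (rule Least_le)
  have nth: "xs ! (p - i) = d i" if "1 \<le> i" "i \<le> p" for i
    using that by (simp add: xs_def)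
  have len: "length xs = p"
    by (simp add: xs_def)
  \<comment> \<open>Lowering the left index of the first root in row \<open>Suc i\<close> gives a
    root of the ideal in row \<open>i\<close>, with the same column and hence an offset larger by
    one.\<close>
  have d_le_Suc: "d i \<le> d (Suc i) + 1" if "1 \<le> i" "Suc i \<le> p" for i
  proof (rule d_le)
    show "Q i (d (Suc i) + 1)"
      using Qd[OF that(2)] unfolding Q_def
    proof
      assume r: "root_A (Suc i) (Suc i + 1 + d (Suc i)) \<in> I"
      then have "root_A (Suc i) (Suc i + 1 + d (Suc i)) \<in> pos_roots_A p"
        using sub by blast
      then obtain k l where "root_A (Suc i) (Suc i + 1 + d (Suc i)) = root_A k l"
          "k < l" "l \<le> p + 1"
        by (auto simp: pos_roots_A_eq)
      then have "Suc i + 1 + d (Suc i) \<le> p + 1"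
        by (subst (asm) root_A_inject) auto
      then have "root_A i (Suc i + 1 + d (Suc i)) \<in> I"
        by (intro up[OF _ r]) (use that in auto)
      then show "i + (d (Suc i) + 1) = p + 1 \<or> root_A i (i + 1 + (d (Suc i) + 1)) \<in> I"
        by simp
    qed simp
  qed
  have "slow 0 xs"
    unfolding slow_iff_nth
  proof (intro allI impI)
    fix k assume k: "k < length xs"
    show "xs ! k \<le> (if k = 0 then 0 else xs ! (k - 1)) + 1"
    proof (cases "k = 0")
      case True
      have "d p \<le> 1" by (rule d_le) (simp add: Q_def)
      then show ?thesis using True k by (simp add: xs_def)
    next
      case False
      then have "p - (k - 1) = Suc (p - k)"
        using k len by simp
      then show ?thesis
        using d_le_Suc[of "p - k"] k len False by (simp add: xs_def)
    qed
  qed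
  moreover have mem: "root_A i j \<in> ideal_of p xs \<longleftrightarrow> root_A i j \<in> I"
    if ij: "1 \<le> i" "i < j" "j \<le> p + 1" for i j
  proof -
    have "root_A i j \<in> I \<longleftrightarrow> i + 1 + d i \<le> j"
    proof
      assume "root_A i j \<in> I"
      then have "Q i (j - i - 1)" using ij by (simp add: Q_def)
      then show "i + 1 + d i \<le> j" using d_le[of i "j - i - 1"] ij by simp
    next
      assume le: "i + 1 + d i \<le> j"
      \<comment> \<open>Since \<open>j \<le> p + 1\<close>, the first disjunct of
        \<open>Q i (d i)\<close> fails.\<close>
      then have "root_A i (i + 1 + d i) \<in> I"
        using Qd[of i] ij by (auto simp: Q_def)
      then show "root_A i j \<in> I"
        by (rule up[rotated]) (use ij le in auto)
    qed
    then show ?thesis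
      using ij by (simp add: root_A_in_ideal_of_iff nth)
  qed
  moreover have "ideal_of p xs = I"
  proof -
    have "ideal_of p xs \<subseteq> pos_roots_A p"
      using ideal_of_is_ideal[OF \<open>slow 0 xs\<close> len] by (simp add: ad_nilpotent_ideal_def)
    then show ?thesis
      using sub mem unfolding pos_roots_A_eq by blast
  qed
  ultimately show ?thesis
    using that len by blast
qed

text \<open>A simple root is the first one in its row, so it lies in the ideal iff its row has no
  missing root.\<close>

lemma card_ideal_of_Int_simple_roots:
  assumes "length xs = p"
  shows "card (ideal_of p xs \<inter> simple_roots_A p) = count_list xs 0"
proof -
  have "ideal_of p xs \<inter> simple_roots_A p = (\<lambda>i. root_A i (i + 1)) ` {i \<in> {1..p}. xs ! (p - i) = 0}"
    unfolding simple_roots_A_eq by (auto simp: root_A_in_ideal_of_iff)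
  moreover have "inj_on (\<lambda>i. root_A i (i + 1)) A" for A
    by (rule inj_onI) (simp add: root_A_inject)
  ultimately have "card (ideal_of p xs \<inter> simple_roots_A p) = card {i \<in> {1..p}. xs ! (p - i) = 0}"
    by (simp add: card_image)
  also have "\<dots> = card {k. k < p \<and> xs ! k = 0}"
    by (rule bij_betw_same_card, rule bij_betw_byWitness[where f = "\<lambda>i. p - i" and f' = "\<lambda>k. p - k"])
      auto
  also have "\<dots> = count_list xs 0"
    using assms by (simp add: count_list_eq_length_filter length_filter_conv_card)
  finally show ?thesis .
qed

lemma bij_betw_ideal_of: "bij_betw (ideal_of p) (slow_lists p 0 m) (Ad_A p m)"
  unfolding bij_betw_def
proof
  show "inj_on (ideal_of p) (slow_lists p 0 m)"
    by (rule inj_onI) (auto simp: slow_lists_def intro: ideal_of_inject)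
  show "ideal_of p ` slow_lists p 0 m = Ad_A p m"
  proof
    show "ideal_of p ` slow_lists p 0 m \<subseteq> Ad_A p m"
      by (auto simp: slow_lists_def Ad_A_def card_ideal_of_Int_simple_roots ideal_of_is_ideal)
    show "Ad_A p m \<subseteq> ideal_of p ` slow_lists p 0 m"
    proof
      fix I assume I: "I \<in> Ad_A p m"
      then obtain xs where "slow 0 xs" "length xs = p" "ideal_of p xs = I"
        using ideal_is_ideal_of unfolding Ad_A_def by blast
      with I show "I \<in> ideal_of p ` slow_lists p 0 m"
        by (auto simp: slow_lists_def Ad_A_def card_ideal_of_Int_simple_roots)
    qed
  qed
qed

theorem theorem3p4:
  fixes p i :: nat
  assumes "p \<ge> 1" and "i \<le> p"
  shows "real (card (Ad_A p i)) = (real i + 1) / (real p + 1) * real ((2 * p - i) choose p)"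
proof -
  have "card (Ad_A p i) = ballot (p - i) i"
    using bij_betw_same_card[OF bij_betw_ideal_of, of p i] assms by (simp add: card_slow_lists)
  \<comment> \<open>For \<open>q = p - i\<close> and \<open>s = i\<close>, \<open>2 * q + s\<close>
    is \<open>2 * p - i\<close> and \<open>q + s + 1\<close> is \<open>p + 1\<close>.\<close>
  moreover have "(p + 1) * ballot (p - i) i = (i + 1) * ((2 * p - i) choose (p - i))"
    using ballot_closed_form[of "p - i" i] assms
    by (simp add: diff_mult_distrib2 mult_2)
  moreover have "(2 * p - i) choose (p - i) = (2 * p - i) choose p"
    using binomial_symmetric[of p "2 * p - i"] assms by simp
  ultimately have "(p + 1) * card (Ad_A p i) = (i + 1) * ((2 * p - i) choose p)"
    by simp
  then have "(real p + 1) * real (card (Ad_A p i)) = (real i + 1) * real ((2 * p - i) choose p)"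
    by (metis of_nat_mult of_nat_add of_nat_1)
  then show ?thesis
    by (simp add: field_simps)
qed

end
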